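(* Let $G$ be a topological group. (1) Let $X$ be a compact metrizable $G$-space. For every $f\in Asp(X)$ the compact space $E^f\subset\mathbb{R}^X$ is a Rosenthal compact. (2) Let $X$ be a metrizable compact RN $G$-space. Then the enveloping semigroup $E=E(X)$ is a (separable) Rosenthal compact with cardinality $\le 2^{\aleph_0}$ (in particular, no subspace of $E$ can be homeomorphic to $\beta\mathbb{N}$).
   Context: A compact $G$-space (compact $G$-system) is a compact Hausdorff space $X$ with a (jointly) continuous left action of the topological group $G$; $\breve g:X\to X$, $x\mapsto gx$. The enveloping semigroup $E(X)$ is the closure of $\{\breve g:g\in G\}$ in $X^X$ with the pointwise convergence topology. For $f\in C(X)$ (continuous real functions), $E^f=\{p_f:p\in E(X)\}\subset\mathbb R^X$, $p_f(x)=f(px)$, with the pointwise topology; it is compact. $f\in Asp(X)$ (Asplund function) means: $f\in C(X)$ and for every countable subgroup $H<G$ the pseudometric space $(X,\rho_{H,f})$ is separable, where $\rho_{H,f}(x,y)=\sup_{h\in H}|f(hx)-f(hy)|$. A topological space is a Rosenthal compact if it is homeomorphic to a pointwise compact subset of the space $B_1(Y)$ of real functions of the first Baire class on some Polish space $Y$. $\beta\mathbb N$ is the Stone-Čech compactification of the discrete space $\mathbb N$. RN: a Banach space $V$ is Asplund if every separable Banach subspace has separable dual. $\mathrm{Iso}(V)$ is the group of linear isometries of $V$ onto itself. $X$ is Radon-Nikodým (RN) if there exist an Asplund space $V$, a strongly continuous co-homomorphism $h:G\to\mathrm{Iso}(V)$ (i.e. $h(gg')=h(g')h(g)$, and $g\mapsto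 h(g)v$ is norm continuous for each $v$), and a bounded topological embedding $\alpha:X\to(V^*,\text{weak}^* )$ with $\alpha(gx)=g\alpha(x)$, where $(g\varphi)(v)=\varphi(h(g)(v))$. *)

theory Defs
  imports "HOL-Analysis.Analysis" "HOL-Algebra.Group_Action"
begin

section \<open>Compact systems and enveloping semigroups\<close>

locale topological_group = group G for G (structure) and TG :: "'g topology" +
  assumes topspace_TG: "topspace TG = carrier G"
    and continuous_mult:
      "continuous_map (prod_topology TG TG) TG (\<lambda>(g, h). g \<otimes> h)"
    and continuous_inv: "continuous_map TG TG (\<lambda>g. inv\<^bsub>G\<^esub> g)"

text \<open>In a \<^locale>\<open>group_action\<close>, every \<open>\<phi> g\<close> is a bijection of the space which is
  \<^const>\<open>undefined\<close> outside of it. Hence \<open>\<phi> g\<close> is a point of the extensional product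
  \<open>X\<^sup>X\<close>; it is the map written with a breve accent over \<open>g\<close> in the literature.\<close>

locale compact_G_space = topological_group G TG + group_action G "topspace X" \<phi>
  for G (structure) and TG and X :: "'x topology" and \<phi> +
  assumes compact_X: "compact_space X"
    and Hausdorff_X: "Hausdorff_space X"
    and continuous_action: "continuous_map (prod_topology TG X) X (\<lambda>(g, x). \<phi> g x)"

definition enveloping_semigroup ::
    "('g, 'm) monoid_scheme \<Rightarrow> 'x topology \<Rightarrow> ('g \<Rightarrow> 'x \<Rightarrow> 'x) \<Rightarrow> ('x \<Rightarrow> 'x) set" where
  "enveloping_semigroup G X \<phi> =
     product_topology (\<lambda>_. X) (topspace X) closure_of (\<phi> ` carrier G)"

definition enveloping_space ::
    "('g, 'm) monoid_scheme \<Rightarrow> 'x topology \<Rightarrow> ('g \<Rightarrow> 'x \<Rightarrow> 'x) \<Rightarrow> ('x \<Rightarrow> 'x) topology" where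
  "enveloping_space G X \<phi> =
     subtopology (product_topology (\<lambda>_. X) (topspace X)) (enveloping_semigroup G X \<phi>)"

text \<open>The space \<open>E\<^sup>f\<close> of the functions \<open>p\<^sub>f(x) = f(p x)\<close>, for \<open>p\<close> in the enveloping semigroup.\<close>

definition enveloping_function_space ::
    "('g, 'm) monoid_scheme \<Rightarrow> 'x topology \<Rightarrow> ('g \<Rightarrow> 'x \<Rightarrow> 'x) \<Rightarrow> ('x \<Rightarrow> real) \<Rightarrow>
      ('x \<Rightarrow> real) topology" where
  "enveloping_function_space G X \<phi> f =
     subtopology (powertop_real (topspace X))
       ((\<lambda>p. \<lambda>x\<in>topspace X. f (p x)) ` enveloping_semigroup G X \<phi>)"

section \<open>Asplund functions\<close>

definition separable_pseudometric :: "'a set \<Rightarrow> ('a \<Rightarrow> 'a \<Rightarrow> real) \<Rightarrow> bool" where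
  "separable_pseudometric M d \<longleftrightarrow>
     (\<exists>D. countable D \<and> D \<subseteq> M \<and> (\<forall>x\<in>M. \<forall>e>0. \<exists>y\<in>D. d x y < e))"

definition orbit_pseudometric ::
    "('g \<Rightarrow> 'x \<Rightarrow> 'x) \<Rightarrow> 'g set \<Rightarrow> ('x \<Rightarrow> real) \<Rightarrow> 'x \<Rightarrow> 'x \<Rightarrow> real" where
  "orbit_pseudometric \<phi> H f x y = (SUP h\<in>H. \<bar>f (\<phi> h x) - f (\<phi> h y)\<bar>)"

definition Asp ::
    "('g, 'm) monoid_scheme \<Rightarrow> 'x topology \<Rightarrow> ('g \<Rightarrow> 'x \<Rightarrow> 'x) \<Rightarrow> ('x \<Rightarrow> real) set" where
  "Asp G X \<phi> = {f. continuous_map X euclideanreal f \<and>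
     (\<forall>H. subgroup H G \<and> countable H \<longrightarrow>
        separable_pseudometric (topspace X) (orbit_pseudometric \<phi> H f))}"

section \<open>Asplund spaces and Radon-Nikodym systems\<close>

text \<open>The dual of a linear subspace \<open>W\<close>: bounded linear functionals defined on \<open>W\<close> only, with
  the metric given by the norm of the dual.\<close>

definition subspace_dual :: "'v::real_normed_vector set \<Rightarrow> ('v \<Rightarrow> real) set" where
  "subspace_dual W = {u \<in> extensional W.
     (\<forall>x\<in>W. \<forall>y\<in>W. u (x + y) = u x + u y) \<and>
     (\<forall>c. \<forall>x\<in>W. u (c *\<^sub>R x) = c * u x) \<and>
     (\<exists>B. \<forall>x\<in>W. \<bar>u x\<bar> \<le> B * norm x)}"

definition subspace_dual_dist ::
    "'v::real_normed_vector set \<Rightarrow> ('v \<Rightarrow> real) \<Rightarrow> ('v \<Rightarrow> real) \<Rightarrow> real" where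
  "subspace_dual_dist W u w = (SUP x\<in>{x\<in>W. norm x \<le> 1}. \<bar>u x - w x\<bar>)"

definition Asplund_space :: "'v::banach itself \<Rightarrow> bool" where
  "Asplund_space _ \<longleftrightarrow>
     (\<forall>W :: 'v set. subspace W \<and> closed W \<and> separable_space (top_of_set W) \<longrightarrow>
        separable_pseudometric (subspace_dual W) (subspace_dual_dist W))"

definition Iso :: "('v::real_normed_vector \<Rightarrow>\<^sub>L 'v) set" where
  "Iso = {T. (\<forall>v. norm (blinfun_apply T v) = norm v) \<and> surj (blinfun_apply T)}"

text \<open>On the dual \<^typ>\<open>'v \<Rightarrow>\<^sub>L real\<close>, the strong operator topology is the topology of pointwise
  convergence on \<^typ>\<open>'v\<close>, that is, the weak* topology.\<close>

abbreviation weak_star :: "('v::real_normed_vector \<Rightarrow>\<^sub>L real) topology" where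
  "weak_star \<equiv> strong_operator_topology"

text \<open>The system is representable on the Banach space \<^typ>\<open>'v\<close>, and \<^typ>\<open>'v\<close> is Asplund. The
  system is RN iff this holds for some \<^typ>\<open>'v\<close>. HOL cannot quantify existentially over types,
  but as a hypothesis the existential is the same as a free type variable: "RN implies P"
  reads "for every \<^typ>\<open>'v\<close>, \<open>RN_G_space TYPE('v)\<close> implies P".\<close>

definition RN_G_space ::
    "'v::banach itself \<Rightarrow> ('g, 'm) monoid_scheme \<Rightarrow> 'g topology \<Rightarrow> 'x topology \<Rightarrow>
      ('g \<Rightarrow> 'x \<Rightarrow> 'x) \<Rightarrow> bool" where
  "RN_G_space V G TG X \<phi> \<longleftrightarrow> Asplund_space V \<and>
     (\<exists>(h :: 'g \<Rightarrow> 'v \<Rightarrow>\<^sub>L 'v) (\<alpha> :: 'x \<Rightarrow> 'v \<Rightarrow>\<^sub>L real).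
        h \<in> carrier G \<rightarrow> Iso \<and>
        (\<forall>g\<in>carrier G. \<forall>g'\<in>carrier G. h (g \<otimes>\<^bsub>G\<^esub> g') = h g' o\<^sub>L h g) \<and>
        (\<forall>v. continuous_map TG euclidean (\<lambda>g. blinfun_apply (h g) v)) \<and>
        embedding_map X weak_star \<alpha> \<and>
        bounded (\<alpha> ` topspace X) \<and>
        (\<forall>g\<in>carrier G. \<forall>x\<in>topspace X. \<alpha> (\<phi> g x) = \<alpha> x o\<^sub>L h g))"

section \<open>Rosenthal compacta\<close>

definition Polish_space :: "'y topology \<Rightarrow> bool" where
  "Polish_space Y \<longleftrightarrow> completely_metrizable_space Y \<and> separable_space Y"

definition Baire_one :: "'y topology \<Rightarrow> ('y \<Rightarrow> real) set" where
  "Baire_one Y = {f \<in> extensional (topspace Y).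
     \<exists>u :: nat \<Rightarrow> 'y \<Rightarrow> real. (\<forall>n. continuous_map Y euclideanreal (u n)) \<and>
       (\<forall>y\<in>topspace Y. (\<lambda>n. u n y) \<longlonglongrightarrow> f y)}"

text \<open>The points of \<open>Y\<close> are taken from the type \<^typ>\<open>nat \<Rightarrow> real\<close>, with an arbitrary Polish
  topology on an arbitrary set of points. This loses no generality, since every Polish space
  has a homeomorphic copy of this kind: see \<open>Polish_space_copy\<close> below.\<close>

definition Rosenthal_compact :: "'a topology \<Rightarrow> bool" where
  "Rosenthal_compact T \<longleftrightarrow>
     (\<exists>(Y :: (nat \<Rightarrow> real) topology) K. Polish_space Y \<and> K \<subseteq> Baire_one Y \<and>
        compactin (powertop_real (topspace Y)) K \<and>
        T homeomorphic_space subtopology (powertop_real (topspace Y)) K)"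

lemma Polish_space_copy:
  fixes Y :: "'y topology"
  assumes "Polish_space Y"
  shows "\<exists>Z :: (nat \<Rightarrow> real) topology. Polish_space Z \<and> Y homeomorphic_space Z"
proof -
  obtain M d where M: "Metric_space M d" and Y: "Y = Metric_space.mtopology M d"
    using assms unfolding Polish_space_def completely_metrizable_space_def by blast
  interpret Metric_space M d by (rule M)
  have top: "topspace Y = M" by (simp add: Y)
  obtain D where D: "countable D" "D \<subseteq> M" "Y closure_of D = M"
    using assms top unfolding Polish_space_def separable_space_def by metis
  define f where "f x = (\<lambda>n. d x (from_nat_into D n))" for x
  have inj: "inj_on f M"
  proof (rule inj_onI, rule ccontr)
    fix x y assume xy: "x \<in> M" "y \<in> M" "f x = f y" "x \<noteq> y"
    then have "d x y / 2 > 0" by simp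
    moreover have "x \<in> mtopology closure_of D" using D(3) xy(1) by (simp add: Y)
    ultimately obtain z where z: "z \<in> D" "z \<in> mball x (d x y / 2)"
      unfolding metric_closure_of by blast
    then obtain n where "from_nat_into D n = z"
      by (metis D(1) from_nat_into_surj)
    with fun_cong[OF xy(3), of n] have "d x z = d y z" by (simp add: f_def)
    moreover have "d x z < d x y / 2" "z \<in> M" using z(2) by auto
    moreover have "d x y \<le> d x z + d z y" using \<open>z \<in> M\<close> xy triangle by blast
    ultimately show False by (simp add: commute)
  qed
  define g where "g = inv_into M f"
  define Z where "Z = pullback_topology (f ` M) g Y"
  have gf: "g (f x) = x" if "x \<in> M" for x using inj that by (simp add: g_def)
  have topZ: "topspace Z = f ` M"
    using gf top by (auto simp: Z_def topspace_pullback_topology)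
  have "homeomorphic_maps Y Z f g"
    unfolding homeomorphic_maps_def
  proof (intro conjI ballI)
    show "continuous_map Y Z f"
      unfolding Z_def
    proof (rule continuous_map_pullback')
      show "continuous_map Y Y (g \<circ> f)"
        by (rule continuous_map_eq[OF continuous_map_id]) (simp add: gf top)
    qed (auto simp: top)
    show "continuous_map Z Y g"
      using continuous_map_pullback[OF continuous_map_id, of "f ` M" g Y] by (simp add: Z_def)
  qed (use gf in \<open>auto simp: top topZ\<close>)
  then have "Y homeomorphic_space Z" unfolding homeomorphic_space_def by blast
  then show ?thesis
    using assms homeomorphic_completely_metrizable_space homeomorphic_separable_space
    unfolding Polish_space_def by blast
qed

section \<open>Stone-Cech compactification\<close>

text \<open>\<open>\<beta>Y\<close> is the closure of the image of \<open>Y\<close> under the evaluation map into the cube \<open>[0,1]\<^sup>C\<close>,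
  where \<open>C\<close> is the set of all continuous functions from \<open>Y\<close> to \<open>[0,1]\<close>.\<close>

definition Stone_Cech :: "'y topology \<Rightarrow> (('y \<Rightarrow> real) \<Rightarrow> real) topology" where
  "Stone_Cech Y =
     (let C = {u \<in> extensional (topspace Y). continuous_map Y (top_of_set {0..1}) u};
          cube = product_topology (\<lambda>_. top_of_set {0..1::real}) C
      in subtopology cube (cube closure_of ((\<lambda>y. \<lambda>u\<in>C. u y) ` topspace Y)))"

abbreviation beta_nat :: "((nat \<Rightarrow> real) \<Rightarrow> real) topology" where
  "beta_nat \<equiv> Stone_Cech (discrete_topology UNIV)"

end

theory Submission
  imports Defs "HOL-Algebra.Generated_Groups"
begin

text \<open>
  The compact spaces in question turn out to be metrizable: countably many continuous real
  functions separate their points. From this everything else follows. A countable separating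
  family embeds a compact space into a countable power of the line, that is, into the space of
  all functions on a countable discrete space; that space is Polish, and every function on it is
  continuous, hence of the first Baire class (\<open>countably_separated_Rosenthal\<close>). Compact
  metrizable spaces are second countable, hence separable and of at most continuum cardinality,
  and \<open>\<beta>\<nat>\<close> is not metrizable (\<open>not_metrizable_beta_nat\<close>), so it does not embed.

  For an Asplund function \<open>f\<close> the countable separating family comes from a Lipschitz estimate.
  Since \<open>X \<times> X\<close> is second countable, some countable subgroup \<open>H\<close> satisfies
  \<open>\<bar>f (g x) - f (g y)\<bar> \<le> \<rho> x y\<close> for all \<open>g\<close> in \<open>G\<close>, where \<open>\<rho>\<close> is the pseudometric of \<open>H\<close> and
  \<open>f\<close> (\<open>countable_subgroup_norming\<close>). The estimate passes to pointwise limits: each \<open>p\<^sub>f\<close> with \<open>p\<close>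
  in the enveloping semigroup is 1-Lipschitz for \<open>\<rho>\<close>, hence determined by its values on a
  countable \<open>\<rho>\<close>-dense set \<open>D\<close> (\<open>Asp_countable_determining_set\<close>). So the evaluations at the points
  of \<open>D\<close> separate the points of \<open>E\<^sup>f\<close>.

  For a Radon-Nikodym system, every matrix coefficient \<open>x \<mapsto> \<alpha>(x)(v)\<close> is an Asplund function:
  the orbit of \<open>v\<close> under a countable subgroup lies in a separable closed subspace \<open>W\<close>, and the
  pseudometric is dominated by the norm of the dual of \<open>W\<close>, which is separable
  (\<open>matrix_coefficient_Asp\<close>). Countably many matrix coefficients \<open>f\<close> separate the points of \<open>X\<close>,
  and each of them has its countable set \<open>D\<close> as above; so the countably many functions
  \<open>p \<mapsto> f (p d)\<close> with \<open>d \<in> D\<close> separate the points of the enveloping semigroup.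
\<close>

section \<open>Countability in compact metrizable spaces\<close>

lemma compact_metrizable_imp_second_countable:
  assumes "compact_space X" "metrizable_space X"
  shows "second_countable X"
proof -
  obtain M d where M: "Metric_space M d" and X: "X = Metric_space.mtopology M d"
    using assms(2) unfolding metrizable_space_def by blast
  interpret Metric_space M d by (rule M)
  have "mtotally_bounded M"
    using assms(1) compactin_imp_mtotally_bounded unfolding X compact_space_def by simp
  then have "\<exists>K. finite K \<and> K \<subseteq> M \<and> M \<subseteq> (\<Union>x\<in>K. mball x (1 / Suc n))" for n
    unfolding mtotally_bounded_def by simp
  then obtain K where K: "\<And>n. finite (K n)" "\<And>n. K n \<subseteq> M"
      "\<And>n::nat. M \<subseteq> (\<Union>x\<in>K n. mball x (1 / Suc n))"
    by metis
  define \<B> where "\<B> = (\<Union>n. (\<lambda>x. mball x (1 / Suc n)) ` K n)"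
  have "\<exists>V\<in>\<B>. x \<in> V \<and> V \<subseteq> U" if U: "openin X U" "x \<in> U" for U x
  proof -
    obtain r where r: "x \<in> M" "r > 0" "mball x r \<subseteq> U"
      using U unfolding X openin_mtopology by blast
    obtain n where n: "1 / Suc n < r / 2"
      using r(2) nat_approx_posE[of "r / 2"] by auto
    obtain c where c: "c \<in> K n" "x \<in> mball c (1 / Suc n)"
      using K(3) r(1) by blast
    have "mball c (1 / Suc n) \<subseteq> mball x r"
    proof
      fix y assume y: "y \<in> mball c (1 / Suc n)"
      have "d x y \<le> d c x + d c y"
        using triangle[of x c y] c y commute by auto
      then show "y \<in> mball x r" using c y n r(1) by auto
    qed
    then show ?thesis using c r(3) unfolding \<B>_def by blast
  qed
  moreover have "countable \<B>" unfolding \<B>_def using K(1) by (auto intro: countable_finite)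
  moreover have "\<forall>V\<in>\<B>. openin X V" unfolding \<B>_def X by auto
  ultimately show ?thesis unfolding second_countable_def by blast
qed

text \<open>The Lindelof property of all open subspaces at once: choose one index for each basic open
  set that is contained in some member of the family.\<close>

lemma second_countable_countable_subfamily:
  assumes "second_countable X" and U: "\<And>i. i \<in> I \<Longrightarrow> openin X (U i)"
  obtains J where "countable J" "J \<subseteq> I" "\<Union>(U ` J) = \<Union>(U ` I)"
proof -
  obtain \<B> where B: "countable \<B>"
      "\<And>V x. openin X V \<Longrightarrow> x \<in> V \<Longrightarrow> \<exists>W\<in>\<B>. x \<in> W \<and> W \<subseteq> V"
    using assms(1) unfolding second_countable_def by metis
  define \<C> where "\<C> = {W\<in>\<B>. \<exists>i\<in>I. W \<subseteq> U i}"
  define k where "k W = (SOME i. i \<in> I \<and> W \<subseteq> U i)" for W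
  have k: "k W \<in> I \<and> W \<subseteq> U (k W)" if "W \<in> \<C>" for W
    unfolding k_def by (rule someI_ex) (use that in \<open>auto simp: \<C>_def\<close>)
  show thesis
  proof
    show "countable (k ` \<C>)" using B(1) unfolding \<C>_def by auto
    show sub: "k ` \<C> \<subseteq> I" using k by auto
    show "\<Union>(U ` (k ` \<C>)) = \<Union>(U ` I)"
    proof (rule equalityI)
      show "\<Union>(U ` (k ` \<C>)) \<subseteq> \<Union>(U ` I)"
        using sub by (intro Union_mono image_mono)
      show "\<Union>(U ` I) \<subseteq> \<Union>(U ` (k ` \<C>))"
      proof
        fix x assume "x \<in> \<Union>(U ` I)"
        then obtain i where i: "i \<in> I" "x \<in> U i" by auto
        from B(2)[OF U[OF i(1)] i(2)] obtain W where W: "W \<in> \<B>" "x \<in> W" "W \<subseteq> U i" by auto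
        with i have "W \<in> \<C>" unfolding \<C>_def by auto
        with k[of W] W(2) show "x \<in> \<Union>(U ` (k ` \<C>))" by auto
      qed
    qed
  qed
qed

text \<open>A point is coded by the set of indices of the basic open sets that contain it.\<close>

lemma second_countable_Hausdorff_lepoll:
  assumes "second_countable X" "Hausdorff_space X"
  shows "topspace X \<lesssim> (UNIV :: nat set set)"
proof -
  obtain \<B> where B: "countable \<B>"
      "\<And>V x. openin X V \<Longrightarrow> x \<in> V \<Longrightarrow> \<exists>W\<in>\<B>. x \<in> W \<and> W \<subseteq> V"
    using assms(1) unfolding second_countable_def by metis
  define c where "c x = {n. x \<in> from_nat_into \<B> n}" for x
  have "inj_on c (topspace X)"
  proof (rule inj_onI, rule ccontr)
    fix x y assume xy: "x \<in> topspace X" "y \<in> topspace X" "c x = c y" "x \<noteq> y"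
    then obtain U V where "openin X U" "openin X V" "x \<in> U" "y \<in> V" "disjnt U V"
      using assms(2) unfolding Hausdorff_space_def by metis
    then obtain W where W: "W \<in> \<B>" "x \<in> W" "y \<notin> W"
      using B(2) unfolding disjnt_def by blast
    then obtain n where "from_nat_into \<B> n = W" using B(1) from_nat_into_surj by metis
    then have "n \<in> c x" "n \<notin> c y" using W by (auto simp: c_def)
    with xy(3) show False by simp
  qed
  then show ?thesis unfolding lepoll_def by blast
qed

section \<open>Compact spaces with a countable separating family of functions\<close>

definition separates_points :: "('a \<Rightarrow> 'b) set \<Rightarrow> 'a set \<Rightarrow> bool" where
  "separates_points F S \<longleftrightarrow> (\<forall>x\<in>S. \<forall>y\<in>S. (\<forall>u\<in>F. u x = u y) \<longrightarrow> x = y)"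

text \<open>The diagonal of the family is a continuous injection of a compact space into a Hausdorff
  space, hence an embedding. The family is indexed, not just a set of functions, so that the index
  set can be made the point set of a Polish space of the type that \<^const>\<open>Rosenthal_compact\<close>
  prescribes.\<close>

lemma compact_separated_homeomorphic:
  fixes e :: "'i \<Rightarrow> 'a \<Rightarrow> real"
  assumes "compact_space T"
    and cont: "\<And>i. i \<in> I \<Longrightarrow> continuous_map T euclideanreal (e i)"
    and sep: "separates_points (e ` I) (topspace T)"
  defines "K \<equiv> (\<lambda>x. \<lambda>i\<in>I. e i x) ` topspace T"
  shows "compactin (powertop_real I) K"
    and "T homeomorphic_space subtopology (powertop_real I) K"
proof -
  define E where "E x = (\<lambda>i\<in>I. e i x)" for x
  have K: "K = E ` topspace T" unfolding K_def E_def by simp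
  have E: "continuous_map T (powertop_real I) E"
    unfolding continuous_map_componentwise E_def by (auto simp: cont cong: restrict_cong)
  show "compactin (powertop_real I) K"
    using image_compactin[OF _ E] assms(1) unfolding K compact_space_def by blast
  have "inj_on E (topspace T)"
  proof (rule inj_onI)
    fix x y assume xy: "x \<in> topspace T" "y \<in> topspace T" "E x = E y"
    have "e i x = e i y" if "i \<in> I" for i using fun_cong[OF xy(3), of i] that by (simp add: E_def)
    then show "x = y" using sep xy unfolding separates_points_def by blast
  qed
  moreover have "topspace (subtopology (powertop_real I) K) = K"
    using continuous_map_image_subset_topspace[OF E] K by auto
  ultimately have "homeomorphic_map T (subtopology (powertop_real I) K) E"
    using E assms(1)
    by (intro continuous_imp_homeomorphic_map)
       (auto simp: K continuous_map_in_subtopology Hausdorff_space_subtopology Hausdorff_space_product_topology)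
  then show "T homeomorphic_space subtopology (powertop_real I) K"
    by (rule homeomorphic_map_imp_homeomorphic_space)
qed

lemma countably_separated_metrizable:
  fixes F :: "('a \<Rightarrow> real) set"
  assumes "compact_space T" "countable F"
    and cont: "\<And>u. u \<in> F \<Longrightarrow> continuous_map T euclideanreal u"
    and sep: "separates_points F (topspace T)"
  shows "metrizable_space T"
proof -
  have "countable {i\<in>F. \<not> (\<exists>a. topspace euclideanreal \<subseteq> {a})}"
    by (rule countable_subset[OF _ assms(2)]) auto
  then have "metrizable_space (powertop_real F)"
    unfolding metrizable_space_product_topology by (simp add: metrizable_space_euclidean)
  moreover have "T homeomorphic_space subtopology (powertop_real F)
      ((\<lambda>x. \<lambda>u\<in>F. u x) ` topspace T)"
    using compact_separated_homeomorphic(2)[OF assms(1) cont, of F] sep by simp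
  ultimately show ?thesis
    using homeomorphic_metrizable_space metrizable_space_subtopology by blast
qed

text \<open>The Polish space is countable and discrete, so that all functions on it are continuous.\<close>

lemma countably_separated_Rosenthal:
  fixes F :: "('a \<Rightarrow> real) set"
  assumes "compact_space T" "countable F"
    and cont: "\<And>u. u \<in> F \<Longrightarrow> continuous_map T euclideanreal u"
    and sep: "separates_points F (topspace T)"
  shows "Rosenthal_compact T"
proof -
  \<comment> \<open>The zero function makes the family nonempty, hence the range of a sequence. The constant
    sequences serve as a copy of the natural numbers.\<close>
  define F' where "F' = insert (\<lambda>_. 0) F"
  define c :: "nat \<Rightarrow> nat \<Rightarrow> real" where "c n = (\<lambda>_. real n)" for n
  define I where "I = range c"
  define e where "e i = from_nat_into F' (inv_into UNIV c i)" for i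
  define K where "K = (\<lambda>x. \<lambda>i\<in>I. e i x) ` topspace T"
  have c: "inv_into UNIV c (c n) = n" for n
    by (rule inv_f_f) (auto simp: inj_def c_def fun_eq_iff)
  have F': "countable F'" "F' \<noteq> {}" using assms(2) by (auto simp: F'_def)
  have cont': "continuous_map T euclideanreal (e i)" for i
    using from_nat_into[OF F'(2), of "inv_into UNIV c i"] cont by (auto simp: e_def F'_def)
  have sep': "separates_points (e ` I) (topspace T)"
    unfolding separates_points_def
  proof (intro ballI impI)
    fix x y assume xy: "x \<in> topspace T" "y \<in> topspace T" "\<forall>u\<in>e ` I. u x = u y"
    have "u x = u y" if "u \<in> F" for u
    proof -
      obtain n where "from_nat_into F' n = u"
        using F' from_nat_into_surj[of F' u] \<open>u \<in> F\<close> by (auto simp: F'_def)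
      then have "e (c n) = u" by (simp add: e_def c)
      then show ?thesis using xy(3) by (auto simp: I_def)
    qed
    then show "x = y" using sep xy unfolding separates_points_def by blast
  qed
  define Y where "Y = discrete_topology I"
  have Y: "topspace Y = I" by (simp add: Y_def)
  have "Polish_space Y"
    unfolding Polish_space_def Y_def
    by (simp add: completely_metrizable_space_discrete_topology separable_space_discrete_topology I_def)
  moreover have "K \<subseteq> Baire_one Y"
  proof
    fix k assume "k \<in> K"
    then have "k \<in> extensional (topspace Y)" by (auto simp: K_def Y)
    moreover have "continuous_map Y euclideanreal k" by (simp add: Y_def Pi_iff)
    ultimately show "k \<in> Baire_one Y" unfolding Baire_one_def by (auto intro: exI[of _ "\<lambda>_. k"])
  qed
  moreover have "compactin (powertop_real (topspace Y)) K"
    unfolding Y K_def by (rule compact_separated_homeomorphic(1)[OF assms(1) cont' sep'])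
  moreover have "T homeomorphic_space subtopology (powertop_real (topspace Y)) K"
    unfolding Y K_def by (rule compact_separated_homeomorphic(2)[OF assms(1) cont' sep'])
  ultimately show ?thesis unfolding Rosenthal_compact_def by blast
qed

section \<open>The Stone-Cech compactification of the natural numbers\<close>

lemma compact_space_Stone_Cech: "compact_space (Stone_Cech Y)"
  unfolding Stone_Cech_def Let_def
  by (intro compact_space_subtopology closedin_compact_space closedin_closure_of)
     (simp_all add: compact_space_product_topology compact_space_subtopology)

text \<open>A compact metrizable space is sequentially compact, but the sequence of the natural numbers
  has no convergent subsequence in \<open>\<beta>\<nat>\<close>.\<close>

lemma not_metrizable_beta_nat: "\<not> metrizable_space beta_nat"
proof
  assume "metrizable_space beta_nat"
  then obtain M d where M: "Metric_space M d" and eq: "beta_nat = Metric_space.mtopology M d"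
    unfolding metrizable_space_def by blast
  interpret Metric_space M d by (rule M)
  define C where "C = {u :: nat \<Rightarrow> real. u \<in> extensional UNIV \<and>
    continuous_map (discrete_topology UNIV) (top_of_set {0..1}) u}"
  define Q where "Q = product_topology (\<lambda>_. top_of_set {0..1::real}) C"
  define \<sigma> where "\<sigma> n = (\<lambda>u\<in>C. u n)" for n :: nat
  have beta: "beta_nat = subtopology Q (Q closure_of range \<sigma>)"
    by (simp add: Stone_Cech_def Let_def C_def Q_def \<sigma>_def)
  have C: "u \<in> C" if "\<And>n. u n \<in> {0..1}" for u
    using that by (auto simp: C_def Pi_iff)
  have "range \<sigma> \<subseteq> topspace Q"
    by (auto simp: \<sigma>_def Q_def C_def PiE_iff Pi_iff split: if_splits)
  then have "range \<sigma> \<subseteq> topspace beta_nat"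
    unfolding beta by (simp add: closure_of_subset)
  then have "range \<sigma> \<subseteq> M" by (simp add: eq)
  moreover have "compact_space mtopology" using compact_space_Stone_Cech eq by metis
  ultimately obtain l r where lr: "strict_mono r" "limitin mtopology (\<sigma> \<circ> r) l sequentially"
    unfolding compact_space_sequentially by blast
  \<comment> \<open>The function that alternates between 0 and 1 along the subsequence extends to the
    compactification, where it would have to converge along the subsequence.\<close>
  define u where "u n = (if \<exists>k. n = r (2 * k) then 0 else 1 :: real)" for n
  have u: "u \<in> C" by (rule C) (simp add: u_def)
  have "continuous_map beta_nat euclideanreal (\<lambda>z. z u)"
    unfolding beta Q_def
    using continuous_map_product_projection[OF u, of "\<lambda>_. top_of_set {0..1::real}"]
    by (auto intro: continuous_map_from_subtopology continuous_map_into_fulltopology)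
  from continuous_map_limit[OF this[unfolded eq] lr(2)]
  have lim: "(\<lambda>k. u (r k)) \<longlonglongrightarrow> l u" by (simp add: o_def \<sigma>_def u)
  have "u (r (2 * k)) = 0" "u (r (2 * k + 1)) = 1" for k
    using strict_mono_eq[OF lr(1)] by (auto simp: u_def) presburger
  moreover have "(\<lambda>k. u (r (2 * k))) \<longlonglongrightarrow> l u" "(\<lambda>k. u (r (2 * k + 1))) \<longlonglongrightarrow> l u"
    using LIMSEQ_subseq_LIMSEQ[OF lim, of "\<lambda>k. 2 * k"]
      LIMSEQ_subseq_LIMSEQ[OF lim, of "\<lambda>k. 2 * k + 1"]
    by (auto simp: o_def strict_mono_def)
  ultimately have "l u = 0" "l u = 1" by (simp_all add: LIMSEQ_const_iff)
  then show False by simp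
qed

section \<open>Reduction to a countable subgroup\<close>

text \<open>The generated subgroup consists of the products of words over the generators and their
  inverses.\<close>

lemma (in group) countable_generate:
  assumes "A \<subseteq> carrier G" "countable A"
  shows "countable (generate G A)"
proof -
  define S where "S = A \<union> (\<lambda>a. inv a) ` A"
  define P where "P ws = foldr (\<otimes>) ws \<one>" for ws
  have S: "S \<subseteq> carrier G" using assms(1) by (auto simp: S_def)
  have P: "P ws \<in> carrier G" if "ws \<in> lists S" for ws
    using that S unfolding P_def by (induction ws) auto
  have P_append: "P (ws @ vs) = P ws \<otimes> P vs" if "ws \<in> lists S" "vs \<in> lists S" for ws vs
    using that(1)
  proof (induction ws)
    case Nil
    then show ?case using P[OF that(2)] by (simp add: P_def)
  next
    case (Cons a ws)
    then have "P ws \<in> carrier G" "a \<in> carrier G" "P (ws @ vs) = P ws \<otimes> P vs"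
      using P S by auto
    then show ?case using P[OF that(2)] by (simp add: P_def m_assoc)
  qed
  have "generate G A \<subseteq> P ` lists S"
  proof
    fix g assume "g \<in> generate G A"
    then show "g \<in> P ` lists S"
    proof (induction rule: generate.induct)
      case one
      have "P [] = \<one>" by (simp add: P_def)
      then show ?case by (metis image_eqI lists.Nil)
    next
      case (incl a)
      then have "P [a] = a" "[a] \<in> lists S" using assms(1) by (auto simp: P_def S_def)
      then show ?case by (metis image_eqI)
    next
      case (inv a)
      then have "P [inv a] = inv a" "[inv a] \<in> lists S" using assms(1) by (auto simp: P_def S_def)
      then show ?case by (metis image_eqI)
    next
      case (eng a b)
      then obtain ws vs where w: "ws \<in> lists S" "vs \<in> lists S" "a = P ws" "b = P vs" by auto
      then have "a \<otimes> b = P (ws @ vs)" "ws @ vs \<in> lists S" using P_append by auto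
      then show ?case by (metis image_eqI)
    qed
  qed
  moreover have "countable (P ` lists S)"
    using assms(2) by (intro countable_image countable_lists) (auto simp: S_def)
  ultimately show ?thesis by (rule countable_subset)
qed

context compact_G_space
begin

lemma action_in_space: "g \<in> carrier G \<Longrightarrow> x \<in> topspace X \<Longrightarrow> \<phi> g x \<in> topspace X"
  by (rule element_image[OF _ _ refl])

lemma continuous_map_action:
  assumes "g \<in> carrier G" shows "continuous_map X X (\<phi> g)"
proof -
  have "continuous_map X (prod_topology TG X) (\<lambda>x. (g, x))"
    using assms topspace_TG by (intro continuous_map_pairedI) auto
  from continuous_map_compose[OF this continuous_action] show ?thesis by (simp add: o_def)
qed

lemma second_countable_square:
  assumes "metrizable_space X"
  shows "second_countable (prod_topology X X)"
  using assms compact_X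
  by (intro compact_metrizable_imp_second_countable)
    (simp_all add: compact_space_prod_topology metrizable_space_prod_topology)

lemma bdd_above_orbit_differences:
  assumes f: "continuous_map X euclideanreal f" and "H \<subseteq> carrier G"
    and "x \<in> topspace X" "y \<in> topspace X"
  shows "bdd_above ((\<lambda>h. \<bar>f (\<phi> h x) - f (\<phi> h y)\<bar>) ` H)"
proof -
  have "compactin euclideanreal (f ` topspace X)"
    using compact_X f unfolding compact_space_def by (rule image_compactin)
  then have "bounded (f ` topspace X)" by (simp add: compact_imp_bounded)
  then obtain B where B: "\<And>z. z \<in> topspace X \<Longrightarrow> \<bar>f z\<bar> \<le> B"
    unfolding bounded_iff by auto
  show ?thesis
  proof (rule bdd_aboveI2)
    fix h assume "h \<in> H"
    then have "\<bar>f (\<phi> h x)\<bar> \<le> B" "\<bar>f (\<phi> h y)\<bar> \<le> B"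
      using assms by (auto intro!: B action_in_space)
    then show "\<bar>f (\<phi> h x) - f (\<phi> h y)\<bar> \<le> 2 * B" by linarith
  qed
qed

text \<open>A supremum of continuous functions on a second countable space is already the supremum of
  countably many of them: for each rational level, countably many of the open superlevel sets have
  the same union as all of them. This is applied to \<open>(x, y) \<mapsto> \<bar>f (g x) - f (g y)\<bar>\<close> on
  \<open>X \<times> X\<close>, with \<open>g\<close> ranging over \<open>G\<close>.\<close>

lemma countable_subgroup_norming:
  assumes "metrizable_space X" and f: "continuous_map X euclideanreal f"
  obtains H where "subgroup H G" "countable H"
    "\<And>g x y. g \<in> carrier G \<Longrightarrow> x \<in> topspace X \<Longrightarrow> y \<in> topspace X \<Longrightarrow>
      \<bar>f (\<phi> g x) - f (\<phi> g y)\<bar> \<le> orbit_pseudometric \<phi> H f x y"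
proof -
  let ?XX = "prod_topology X X"
  define \<Delta> where "\<Delta> g z = \<bar>f (\<phi> g (fst z)) - f (\<phi> g (snd z))\<bar>" for g and z :: "'x \<times> 'x"
  define U where "U q g = {z \<in> topspace ?XX. \<Delta> g z \<in> {real_of_rat q<..}}" for q g
  have "second_countable ?XX" by (rule second_countable_square[OF assms(1)])
  moreover have "openin ?XX (U q g)" if "g \<in> carrier G" for q g
  proof -
    have fg: "continuous_map X euclideanreal (\<lambda>x. f (\<phi> g x))"
      using continuous_map_compose[OF continuous_map_action[OF that] f] by (simp add: o_def)
    have "continuous_map ?XX euclideanreal (\<lambda>z. f (\<phi> g (fst z)))"
      using continuous_map_compose[OF continuous_map_fst fg] by (simp add: o_def)
    moreover have "continuous_map ?XX euclideanreal (\<lambda>z. f (\<phi> g (snd z)))"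
      using continuous_map_compose[OF continuous_map_snd fg] by (simp add: o_def)
    ultimately have "continuous_map ?XX euclideanreal (\<Delta> g)"
      unfolding \<Delta>_def by (intro continuous_map_real_abs continuous_map_diff)
    then show ?thesis unfolding U_def by (rule openin_continuous_map_preimage) simp
  qed
  ultimately have "\<exists>A. countable A \<and> A \<subseteq> carrier G \<and> \<Union>(U q ` A) = \<Union>(U q ` carrier G)" for q
    by (metis second_countable_countable_subfamily)
  then obtain A where A: "\<And>q. countable (A q)" "\<And>q. A q \<subseteq> carrier G"
      "\<And>q. \<Union>(U q ` A q) = \<Union>(U q ` carrier G)"
    by metis
  define H where "H = generate G (\<Union>q. A q)"
  have sub: "(\<Union>q. A q) \<subseteq> carrier G" using A(2) by blast
  show thesis
  proof
    show H: "subgroup H G" unfolding H_def by (rule generate_is_subgroup[OF sub])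
    show "countable H" unfolding H_def using A(1) sub by (intro countable_generate) auto
    fix g x y assume gxy: "g \<in> carrier G" "x \<in> topspace X" "y \<in> topspace X"
    show "\<bar>f (\<phi> g x) - f (\<phi> g y)\<bar> \<le> orbit_pseudometric \<phi> H f x y"
    proof (rule ccontr)
      assume "\<not> ?thesis"
      then obtain q where q: "orbit_pseudometric \<phi> H f x y < of_rat q" "of_rat q < \<Delta> g (x, y)"
        using of_rat_dense by (auto simp: \<Delta>_def not_le)
      then have "(x, y) \<in> \<Union>(U q ` carrier G)" using gxy by (auto simp: U_def)
      then obtain h where h: "h \<in> A q" "of_rat q < \<Delta> h (x, y)"
        unfolding A(3)[symmetric] by (auto simp: U_def)
      then have "h \<in> H" unfolding H_def by (intro generate.incl) blast
      then have "\<Delta> h (x, y) \<le> orbit_pseudometric \<phi> H f x y"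
        unfolding orbit_pseudometric_def \<Delta>_def fst_conv snd_conv
        using bdd_above_orbit_differences[OF f subgroup.subset[OF H] gxy(2,3)]
        by (rule cSUP_upper)
      with h(2) q(1) show False by linarith
    qed
  qed
qed

section \<open>Asplund functions on the enveloping semigroup\<close>

lemma enveloping_semigroup_subset:
  "enveloping_semigroup G X \<phi> \<subseteq> topspace X \<rightarrow>\<^sub>E topspace X"
  unfolding enveloping_semigroup_def
  using closure_of_subset_topspace[of "product_topology (\<lambda>_. X) (topspace X)"] by simp

lemma topspace_enveloping_space:
  "topspace (enveloping_space G X \<phi>) = enveloping_semigroup G X \<phi>"
  using enveloping_semigroup_subset by (simp add: enveloping_space_def inf.absorb2)

lemma compact_enveloping_space: "compact_space (enveloping_space G X \<phi>)"
  unfolding enveloping_space_def enveloping_semigroup_def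
  by (intro compact_space_subtopology closedin_compact_space closedin_closure_of)
     (simp add: compact_space_product_topology compact_X)

lemma Hausdorff_enveloping_space: "Hausdorff_space (enveloping_space G X \<phi>)"
  unfolding enveloping_space_def
  by (simp add: Hausdorff_space_subtopology Hausdorff_space_product_topology Hausdorff_X)

lemma continuous_map_enveloping_evaluation:
  assumes "continuous_map X euclideanreal f" "x \<in> topspace X"
  shows "continuous_map (enveloping_space G X \<phi>) euclideanreal (\<lambda>p. f (p x))"
    (is ?enveloping)
    and "continuous_map (product_topology (\<lambda>_. X) (topspace X)) euclideanreal (\<lambda>p. f (p x))"
    (is ?product)
proof -
  show ?product
    using continuous_map_compose[OF continuous_map_product_projection[OF assms(2)] assms(1)]
    by (simp add: o_def)
  then show ?enveloping unfolding enveloping_space_def by (rule continuous_map_from_subtopology)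
qed

text \<open>Equivalently, restriction to \<open>D\<close> is injective on \<open>E\<^sup>f\<close>.\<close>

definition determining_set :: "'x set \<Rightarrow> ('x \<Rightarrow> real) \<Rightarrow> bool" where
  "determining_set D f \<longleftrightarrow> D \<subseteq> topspace X \<and>
    (\<forall>p\<in>enveloping_semigroup G X \<phi>. \<forall>q\<in>enveloping_semigroup G X \<phi>.
      (\<forall>d\<in>D. f (p d) = f (q d)) \<longrightarrow> (\<forall>x\<in>topspace X. f (p x) = f (q x)))"

text \<open>Each \<open>p\<^sub>f\<close> is 1-Lipschitz for the pseudometric of a suitable countable subgroup, because this
  holds for the translates of \<open>f\<close> and is a closed condition on \<open>p\<close>. Hence a countable dense set
  for that pseudometric determines \<open>p\<^sub>f\<close>.\<close>

lemma Asp_countable_determining_set: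
  assumes "metrizable_space X" "f \<in> Asp G X \<phi>"
  shows "\<exists>D. countable D \<and> determining_set D f"
proof -
  have f: "continuous_map X euclideanreal f" using assms(2) unfolding Asp_def by blast
  obtain H where H: "subgroup H G" "countable H"
      "\<And>g x y. g \<in> carrier G \<Longrightarrow> x \<in> topspace X \<Longrightarrow> y \<in> topspace X \<Longrightarrow>
        \<bar>f (\<phi> g x) - f (\<phi> g y)\<bar> \<le> orbit_pseudometric \<phi> H f x y"
    using countable_subgroup_norming[OF assms(1) f] by blast
  let ?\<rho> = "orbit_pseudometric \<phi> H f"
  let ?P = "product_topology (\<lambda>_. X) (topspace X)"
  have "separable_pseudometric (topspace X) ?\<rho>"
    using assms(2) H(1,2) unfolding Asp_def by blast
  then obtain D where D: "countable D" "D \<subseteq> topspace X"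
      "\<And>x e. x \<in> topspace X \<Longrightarrow> e > 0 \<Longrightarrow> \<exists>d\<in>D. ?\<rho> x d < e"
    unfolding separable_pseudometric_def by blast
  have Lipschitz: "\<bar>f (p x) - f (p y)\<bar> \<le> ?\<rho> x y"
    if p: "p \<in> enveloping_semigroup G X \<phi>" and xy: "x \<in> topspace X" "y \<in> topspace X" for p x y
  proof -
    let ?S = "{p \<in> topspace ?P. \<bar>f (p x) - f (p y)\<bar> \<in> {..?\<rho> x y}}"
    have "continuous_map ?P euclideanreal (\<lambda>p. \<bar>f (p x) - f (p y)\<bar>)"
      by (intro continuous_map_real_abs continuous_map_diff continuous_map_enveloping_evaluation f xy)
    then have "closedin ?P ?S" by (rule closedin_continuous_map_preimage) simp
    moreover have "\<phi> ` carrier G \<subseteq> ?S"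
      using H(3)[OF _ xy] bij_prop0 action_in_space by (auto simp: Bij_def PiE_iff)
    ultimately have "enveloping_semigroup G X \<phi> \<subseteq> ?S"
      unfolding enveloping_semigroup_def by (intro closure_of_minimal)
    with p show ?thesis by auto
  qed
  have "determining_set D f"
    unfolding determining_set_def
  proof (intro conjI ballI impI)
    fix p q x
    assume p: "p \<in> enveloping_semigroup G X \<phi>" and q: "q \<in> enveloping_semigroup G X \<phi>"
      and eq: "\<forall>d\<in>D. f (p d) = f (q d)" and x: "x \<in> topspace X"
    have "\<bar>f (p x) - f (q x)\<bar> \<le> 0 + e" if e: "e > 0" for e
    proof -
      obtain d where d: "d \<in> D" "?\<rho> x d < e / 2" using D(3)[OF x half_gt_zero[OF e]] by blast
      then have "d \<in> topspace X" using D(2) by blast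
      from Lipschitz[OF p x this] Lipschitz[OF q x this] bspec[OF eq d(1)] d(2)
      show ?thesis by linarith
    qed
    then have "\<bar>f (p x) - f (q x)\<bar> \<le> 0" by (rule field_le_epsilon)
    then show "f (p x) = f (q x)" by simp
  qed (rule D(2))
  with D(1) show ?thesis by blast
qed

text \<open>The evaluations at the points of a countable determining set separate the points of
  \<open>E\<^sup>f\<close>.\<close>

theorem Rosenthal_enveloping_function_space:
  assumes "metrizable_space X" "f \<in> Asp G X \<phi>"
  shows "Rosenthal_compact (enveloping_function_space G X \<phi> f)"
proof -
  let ?E = "enveloping_semigroup G X \<phi>"
  let ?T = "enveloping_function_space G X \<phi> f"
  define J where "J p = (\<lambda>x\<in>topspace X. f (p x))" for p
  have T: "?T = subtopology (powertop_real (topspace X)) (J ` ?E)"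
    unfolding enveloping_function_space_def J_def ..
  have f: "continuous_map X euclideanreal f" using assms(2) unfolding Asp_def by blast
  have J: "continuous_map (enveloping_space G X \<phi>) (powertop_real (topspace X)) J"
    unfolding continuous_map_componentwise J_def
    by (auto simp: continuous_map_enveloping_evaluation(1)[OF f] cong: restrict_cong)
  have top: "topspace ?T = J ` ?E" by (auto simp: T J_def)
  have "compactin (powertop_real (topspace X)) (J ` ?E)"
    using image_compactin[OF _ J] compact_enveloping_space topspace_enveloping_space
    unfolding compact_space_def by metis
  then have compact: "compact_space ?T" unfolding T by (rule compact_space_subtopology)
  obtain D where D: "countable D" "determining_set D f"
    using Asp_countable_determining_set[OF assms] by blast
  then have D_sub: "D \<subseteq> topspace X" unfolding determining_set_def by blast
  show ?thesis
  proof (rule countably_separated_Rosenthal[OF compact, of "(\<lambda>d u. u d) ` D"])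
    show "countable ((\<lambda>d (u :: 'x \<Rightarrow> real). u d) ` D)" using D(1) by simp
    show "continuous_map ?T euclideanreal u" if "u \<in> (\<lambda>d u. u d) ` D" for u
      using that D_sub unfolding T
      by (auto intro!: continuous_map_from_subtopology continuous_map_product_projection)
    show "separates_points ((\<lambda>d u. u d) ` D) (topspace ?T)"
      unfolding separates_points_def
    proof (intro ballI impI)
      fix a b assume a: "a \<in> topspace ?T" and b: "b \<in> topspace ?T"
        and eq: "\<forall>u\<in>(\<lambda>d u. u d) ` D. u a = u b"
      obtain p q where pq: "p \<in> ?E" "q \<in> ?E" "a = J p" "b = J q" using a b top by auto
      have "f (p d) = f (q d)" if "d \<in> D" for d
      proof -
        have "a d = b d" using bspec[OF eq, of "\<lambda>u. u d"] that by auto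
        then show ?thesis using that D_sub by (auto simp: pq J_def)
      qed
      then have "\<forall>x\<in>topspace X. f (p x) = f (q x)"
        using D(2) pq(1,2) unfolding determining_set_def by blast
      then show "a = b" unfolding pq(3,4) J_def by (auto intro!: restrict_ext)
    qed
  qed
qed

text \<open>If \<open>p\<close> and \<open>q\<close> differ at \<open>x\<close>, then \<open>f (p x)\<close> and \<open>f (q x)\<close> differ for some \<open>f\<close> in the family,
  and then \<open>f (p d)\<close> and \<open>f (q d)\<close> differ for some \<open>d\<close> in the countable determining set of \<open>f\<close>.\<close>

lemma enveloping_space_countably_separated:
  assumes "metrizable_space X" "countable F" "F \<subseteq> Asp G X \<phi>"
    and sep: "separates_points F (topspace X)"
  obtains C where "countable C"
    "\<And>u. u \<in> C \<Longrightarrow> continuous_map (enveloping_space G X \<phi>) euclideanreal u"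
    "separates_points C (topspace (enveloping_space G X \<phi>))"
proof -
  have "\<exists>D. countable D \<and> determining_set D f" if "f \<in> F" for f
    using Asp_countable_determining_set[OF assms(1)] assms(3) that by blast
  then obtain D where D: "\<And>f. f \<in> F \<Longrightarrow> countable (D f)" "\<And>f. f \<in> F \<Longrightarrow> determining_set (D f) f"
    by metis
  define C where "C = (\<Union>f\<in>F. (\<lambda>d p. f (p d)) ` D f)"
  show thesis
  proof
    show "countable C"
      unfolding C_def using assms(2) D(1) by (intro countable_UN countable_image)
    show "continuous_map (enveloping_space G X \<phi>) euclideanreal u" if "u \<in> C" for u
    proof -
      obtain f d where fd: "f \<in> F" "d \<in> D f" "u = (\<lambda>p. f (p d))" using \<open>u \<in> C\<close> by (auto simp: C_def)
      have "continuous_map X euclideanreal f" using assms(3) fd(1) by (auto simp: Asp_def)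
      moreover have "d \<in> topspace X" using D(2)[OF fd(1)] fd(2) unfolding determining_set_def by blast
      ultimately show ?thesis unfolding fd(3) by (rule continuous_map_enveloping_evaluation)
    qed
    show "separates_points C (topspace (enveloping_space G X \<phi>))"
      unfolding separates_points_def topspace_enveloping_space
    proof (intro ballI impI)
      fix p q assume E: "p \<in> enveloping_semigroup G X \<phi>" "q \<in> enveloping_semigroup G X \<phi>"
        and eq: "\<forall>u\<in>C. u p = u q"
      then have pq: "p \<in> topspace X \<rightarrow>\<^sub>E topspace X" "q \<in> topspace X \<rightarrow>\<^sub>E topspace X"
        using enveloping_semigroup_subset by blast+
      have "f (p x) = f (q x)" if f: "f \<in> F" and x: "x \<in> topspace X" for f x
      proof -
        have "f (p d) = f (q d)" if "d \<in> D f" for d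
          using bspec[OF eq, of "\<lambda>p. f (p d)"] f that unfolding C_def by auto
        then show ?thesis using D(2)[OF f] E x unfolding determining_set_def by blast
      qed
      then have "p x = q x" if "x \<in> topspace X" for x
        using sep[unfolded separates_points_def, THEN bspec, THEN bspec, THEN mp,
            OF PiE_mem[OF pq(1) that] PiE_mem[OF pq(2) that]] that by simp
      then show "p = q" by (rule PiE_ext[OF pq])
    qed
  qed
qed

end

section \<open>Matrix coefficients of Radon-Nikodym systems\<close>

text \<open>The witness is the closure of the countable set of rational linear combinations. It is closed
  under real scalars because the rationals are dense in the reals.\<close>

lemma countable_separable_closed_span:
  fixes S :: "'v::real_normed_vector set"
  assumes "countable S"
  obtains W where "S \<subseteq> W" "subspace W" "closed W" "separable_space (top_of_set W)"
proof -
  define lin where "lin xs = (\<Sum>(q, s)\<leftarrow>xs. real_of_rat q *\<^sub>R s)" for xs :: "(rat \<times> 'v) list"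
  define Q where "Q = lin ` lists (UNIV \<times> S)"
  have zero: "0 \<in> Q"
    unfolding Q_def by (rule image_eqI[of _ _ "[]"]) (auto simp: lin_def)
  have add: "x + y \<in> Q" if xy: "x \<in> Q" "y \<in> Q" for x y
  proof -
    obtain xs ys where "x = lin xs" "y = lin ys" "xs \<in> lists (UNIV \<times> S)" "ys \<in> lists (UNIV \<times> S)"
      using xy unfolding Q_def by blast
    then show ?thesis
      unfolding Q_def by (intro image_eqI[of _ _ "xs @ ys"]) (auto simp: lin_def)
  qed
  have scale: "real_of_rat q *\<^sub>R x \<in> Q" if x: "x \<in> Q" for q x
  proof -
    obtain xs where xs: "x = lin xs" "xs \<in> lists (UNIV \<times> S)" using x unfolding Q_def by blast
    have "real_of_rat q *\<^sub>R lin xs = lin (map (\<lambda>(r, s). (q * r, s)) xs)"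
      by (induction xs) (auto simp: lin_def scaleR_right_distrib of_rat_mult)
    moreover have "map (\<lambda>(r, s). (q * r, s)) xs \<in> lists (UNIV \<times> S)" using xs(2) by fastforce
    ultimately show ?thesis unfolding Q_def xs(1) by blast
  qed
  have "S \<subseteq> Q"
  proof
    fix s assume "s \<in> S"
    then show "s \<in> Q"
      unfolding Q_def by (intro image_eqI[of _ _ "[(1, s)]"]) (auto simp: lin_def)
  qed
  show thesis
  proof
    show "S \<subseteq> closure Q" using \<open>S \<subseteq> Q\<close> closure_subset by blast
    show "subspace (closure Q)"
      unfolding subspace_def
    proof (intro conjI ballI allI)
      show "0 \<in> closure Q" using zero closure_subset by blast
      fix x assume x: "x \<in> closure Q"
      then obtain a where a: "\<And>n. a n \<in> Q" "a \<longlonglongrightarrow> x" unfolding closure_sequential by blast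
      {
        fix y assume "y \<in> closure Q"
        then obtain b where b: "\<And>n. b n \<in> Q" "b \<longlonglongrightarrow> y" unfolding closure_sequential by blast
        have "(\<lambda>n. a n + b n) \<longlonglongrightarrow> x + y" using a b by (intro tendsto_add)
        moreover have "a n + b n \<in> Q" for n using add a b by blast
        ultimately show "x + y \<in> closure Q"
          unfolding closure_sequential by (intro exI[of _ "\<lambda>n. a n + b n"]) auto
      }
      fix c :: real
      have "c \<in> closure \<rat>" by (simp add: Rats_closure_real)
      then obtain r where r: "\<And>n. r n \<in> \<rat>" "r \<longlonglongrightarrow> c" unfolding closure_sequential by blast
      then have "(\<lambda>n. r n *\<^sub>R a n) \<longlonglongrightarrow> c *\<^sub>R x" using a by (intro tendsto_scaleR)
      moreover have "r n *\<^sub>R a n \<in> Q" for n using r(1)[of n] scale[OF a(1)] by (auto elim!: Rats_cases)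
      ultimately show "c *\<^sub>R x \<in> closure Q"
        unfolding closure_sequential by (intro exI[of _ "\<lambda>n. r n *\<^sub>R a n"]) auto
    qed
    show "separable_space (top_of_set (closure Q))"
      unfolding separable_space_def
    proof (intro exI conjI)
      show "countable Q" unfolding Q_def using assms by (intro countable_image countable_lists) auto
      show "top_of_set (closure Q) closure_of Q = topspace (top_of_set (closure Q))"
        using closure_subset[of Q] by (simp add: closure_of_subtopology Int_absorb1 inf.absorb2)
    qed (use closure_subset in auto)
  qed simp
qed

text \<open>Separability passes to pullbacks along \<open>r\<close>. The image of \<open>r\<close> need not contain any point of a
  dense set \<open>D\<close> of the codomain, so for each point \<open>z\<close> of \<open>D\<close> and each \<open>n\<close> one picks a point whose
  image is within \<open>1 / (n + 1)\<close> of \<open>z\<close>, if there is one. For a symmetric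
  \<open>d\<close> with the triangle inequality, the domination hypothesis says that \<open>r\<close> pulls \<open>C\<close> times \<open>d\<close>
  back to a pseudometric above \<open>\<rho>\<close>.\<close>

lemma separable_pseudometric_pullback:
  assumes "separable_pseudometric M d" and r: "\<And>x. x \<in> A \<Longrightarrow> r x \<in> M" and "C \<ge> 0"
    and le: "\<And>x y z. x \<in> A \<Longrightarrow> y \<in> A \<Longrightarrow> z \<in> M \<Longrightarrow> \<rho> x y \<le> C * (d (r x) z + d (r y) z)"
  shows "separable_pseudometric A \<rho>"
proof -
  obtain D where D: "countable D" "D \<subseteq> M" "\<And>x e. x \<in> M \<Longrightarrow> e > 0 \<Longrightarrow> \<exists>z\<in>D. d x z < e"
    using assms(1) unfolding separable_pseudometric_def by blast
  define I where "I = {(z, n :: nat). z \<in> D \<and> (\<exists>x\<in>A. d (r x) z < 1 / Suc n)}"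
  have "\<exists>x. x \<in> A \<and> d (r x) (fst i) < 1 / Suc (snd i)" if "i \<in> I" for i
    using that by (auto simp: I_def)
  then obtain a where a: "\<And>i. i \<in> I \<Longrightarrow> a i \<in> A \<and> d (r (a i)) (fst i) < 1 / Suc (snd i)"
    by metis
  have "\<exists>y\<in>a ` I. \<rho> x y < e" if xe: "x \<in> A" "e > 0" for x e
  proof -
    define t where "t = e / (2 * (C + 1))"
    have t: "t > 0" using xe(2) assms(3) by (simp add: t_def)
    obtain n :: nat where n: "1 / Suc n < t" using nat_approx_posE[OF t] by auto
    obtain z where z: "z \<in> D" "d (r x) z < 1 / Suc n" using D(3)[OF r[OF xe(1)]] by (metis of_nat_0_less_iff zero_less_Suc zero_less_divide_1_iff)
    then have i: "(z, n) \<in> I" using xe(1) by (auto simp: I_def)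
    have "\<rho> x (a (z, n)) \<le> C * (d (r x) z + d (r (a (z, n))) z)"
      using le xe(1) a[OF i] z(1) D(2) by blast
    also have "\<dots> \<le> C * (t + t)"
      using a[OF i] z(2) n assms(3) by (intro mult_left_mono) auto
    also have "\<dots> < (C + 1) * (t + t)" using t by (intro mult_strict_right_mono) auto
    also have "\<dots> = e"
    proof -
      have "t * (2 * (C + 1)) = e" using assms(3) by (simp add: t_def)
      then show ?thesis by (simp add: algebra_simps)
    qed
    finally show ?thesis using i by blast
  qed
  moreover have "countable I"
  proof (rule countable_subset)
    show "I \<subseteq> D \<times> UNIV" by (auto simp: I_def)
  qed (use D(1) in auto)
  moreover have "a ` I \<subseteq> A" using a by blast
  ultimately show ?thesis unfolding separable_pseudometric_def by (intro exI[of _ "a ` I"]) auto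
qed

lemma subspace_dual_dist_le:
  assumes W: "subspace W" and u: "u \<in> subspace_dual W" and z: "z \<in> subspace_dual W" and w: "w \<in> W"
  shows "\<bar>u w - z w\<bar> \<le> norm w * subspace_dual_dist W u z"
proof (cases "w = 0")
  case True
  have "u 0 = 0" "z 0 = 0"
    using u z W subspace_0[OF W] unfolding subspace_dual_def
    by (metis (mono_tags, lifting) mem_Collect_eq mult_zero_left scaleR_zero_left)+
  then show ?thesis using True by simp
next
  case False
  obtain B B' where B: "\<And>x. x \<in> W \<Longrightarrow> \<bar>u x\<bar> \<le> B * norm x" "\<And>x. x \<in> W \<Longrightarrow> \<bar>z x\<bar> \<le> B' * norm x"
    using u z unfolding subspace_dual_def by blast
  have "bdd_above ((\<lambda>x. \<bar>u x - z x\<bar>) ` {x\<in>W. norm x \<le> 1})"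
  proof (rule bdd_aboveI2)
    fix x assume x: "x \<in> {x\<in>W. norm x \<le> 1}"
    have "b * norm x \<le> \<bar>b\<bar>" for b
    proof -
      have "b * norm x \<le> \<bar>b\<bar> * norm x" by (intro mult_right_mono) auto
      also have "\<dots> \<le> \<bar>b\<bar>" using x by (intro mult_left_le) auto
      finally show ?thesis .
    qed
    from this[of B] this[of B'] show "\<bar>u x - z x\<bar> \<le> \<bar>B\<bar> + \<bar>B'\<bar>" using B[of x] x by auto
  qed
  moreover define w' where "w' = (1 / norm w) *\<^sub>R w"
  moreover have w': "w' \<in> W" "norm w' = 1" unfolding w'_def using w W False by (auto intro: subspace_scale)
  ultimately have "\<bar>u w' - z w'\<bar> \<le> subspace_dual_dist W u z"
    unfolding subspace_dual_dist_def by (intro cSUP_upper) auto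
  moreover have "u w' = u w / norm w" "z w' = z w / norm w"
    using u z w unfolding w'_def subspace_dual_def by auto
  ultimately show ?thesis using False by (simp add: field_simps abs_divide flip: diff_divide_distrib)
qed

context compact_G_space
begin

text \<open>By equivariance, \<open>\<alpha>(g x)(v)\<close> is the value of \<open>\<alpha>(x)\<close> at \<open>h(g)(v)\<close>, a vector of norm \<open>\<parallel>v\<parallel>\<close>.
  So the orbit pseudometric of \<open>H\<close> is at most \<open>\<parallel>v\<parallel>\<close> times the distance of the functionals in the
  dual of any closed subspace that contains the \<open>H\<close>-orbit of \<open>v\<close>. Such a subspace can be chosen
  separable, and its dual is separable because the Banach space is Asplund.\<close>

lemma matrix_coefficient_Asp:
  fixes h :: "'a \<Rightarrow> 'v::banach \<Rightarrow>\<^sub>L 'v" and \<alpha> :: "'x \<Rightarrow> 'v \<Rightarrow>\<^sub>L real"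
  assumes Asplund: "Asplund_space TYPE('v)" and h: "h \<in> carrier G \<rightarrow> Iso"
    and \<alpha>: "continuous_map X weak_star \<alpha>"
    and equivariant: "\<And>g x. g \<in> carrier G \<Longrightarrow> x \<in> topspace X \<Longrightarrow> \<alpha> (\<phi> g x) = \<alpha> x o\<^sub>L h g"
  shows "(\<lambda>x. \<alpha> x v) \<in> Asp G X \<phi>"
proof -
  have "separable_pseudometric (topspace X) (orbit_pseudometric \<phi> H (\<lambda>x. \<alpha> x v))"
    if H: "subgroup H G" "countable H" for H
  proof -
    obtain W where W: "(\<lambda>g. h g v) ` H \<subseteq> W" "subspace W" "closed W" "separable_space (top_of_set W)"
      by (rule countable_separable_closed_span[OF countable_image[OF H(2)]])
    define r where "r x = restrict (blinfun_apply (\<alpha> x)) W" for x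
    have r: "r x \<in> subspace_dual W" for x
    proof -
      have "\<exists>B. \<forall>w\<in>W. \<bar>\<alpha> x w\<bar> \<le> B * norm w"
        using norm_blinfun[of "\<alpha> x"] by auto
      then show ?thesis
        using W(2) unfolding subspace_dual_def r_def
        by (auto simp: blinfun.add_right blinfun.scaleR_right subspace_add subspace_scale)
    qed
    have "separable_pseudometric (subspace_dual W) (subspace_dual_dist W)"
      using Asplund W(2-4) unfolding Asplund_space_def by blast
    then show ?thesis
    proof (rule separable_pseudometric_pullback[where r = r and C = "norm v"])
      fix x y z assume x: "x \<in> topspace X" and y: "y \<in> topspace X" and z: "z \<in> subspace_dual W"
      show "orbit_pseudometric \<phi> H (\<lambda>x. \<alpha> x v) x y
          \<le> norm v * (subspace_dual_dist W (r x) z + subspace_dual_dist W (r y) z)"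
        unfolding orbit_pseudometric_def
      proof (rule cSUP_least)
        show "H \<noteq> {}" using subgroup.one_closed[OF H(1)] by blast
        fix g assume g: "g \<in> H"
        then have gG: "g \<in> carrier G" using subgroup.subset[OF H(1)] by blast
        have w: "h g v \<in> W" using W(1) g by blast
        have norm: "norm (h g v) = norm v" using h gG by (auto simp: Iso_def)
        have "\<bar>\<alpha> x (h g v) - z (h g v)\<bar> \<le> norm v * subspace_dual_dist W (r x) z"
          using subspace_dual_dist_le[OF W(2) r z w, of x] by (simp add: r_def w norm)
        moreover have "\<bar>\<alpha> y (h g v) - z (h g v)\<bar> \<le> norm v * subspace_dual_dist W (r y) z"
          using subspace_dual_dist_le[OF W(2) r z w, of y] by (simp add: r_def w norm)
        ultimately show "\<bar>\<alpha> (\<phi> g x) v - \<alpha> (\<phi> g y) v\<bar>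
            \<le> norm v * (subspace_dual_dist W (r x) z + subspace_dual_dist W (r y) z)"
          by (simp add: equivariant gG x y distrib_left)
      qed
    qed (use r in auto)
  qed
  moreover have "continuous_map X euclideanreal (\<lambda>x. \<alpha> x v)"
    using \<alpha> continuous_on_strong_operator_topo_iff_coordinatewise by blast
  ultimately show ?thesis unfolding Asp_def by blast
qed

text \<open>All matrix coefficients together separate the points of \<open>X\<close>, since \<open>\<alpha>\<close> is injective. The sets
  of pairs that a single coefficient separates are open in \<open>X \<times> X\<close> and cover the complement of the
  diagonal, so countably many of them suffice.\<close>

lemma RN_countable_separating_Asp:
  assumes "metrizable_space X" "RN_G_space TYPE('v::banach) G TG X \<phi>"
  obtains F where "countable F" "F \<subseteq> Asp G X \<phi>"
    "separates_points F (topspace X)"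
proof -
  obtain h :: "'a \<Rightarrow> 'v \<Rightarrow>\<^sub>L 'v" and \<alpha> :: "'x \<Rightarrow> 'v \<Rightarrow>\<^sub>L real" where
    RN: "Asplund_space TYPE('v)" "h \<in> carrier G \<rightarrow> Iso" "embedding_map X weak_star \<alpha>"
      "\<And>g x. g \<in> carrier G \<Longrightarrow> x \<in> topspace X \<Longrightarrow> \<alpha> (\<phi> g x) = \<alpha> x o\<^sub>L h g"
    using assms(2) unfolding RN_G_space_def by blast
  have \<alpha>: "continuous_map X weak_star \<alpha>"
    using RN(3) homeomorphic_imp_continuous_map unfolding embedding_map_def
    by (blast intro: continuous_map_into_fulltopology)
  have inj: "inj_on \<alpha> (topspace X)"
    using RN(3) homeomorphic_imp_injective_map unfolding embedding_map_def by blast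
  have coefficient: "(\<lambda>x. \<alpha> x v) \<in> Asp G X \<phi>" for v
    by (rule matrix_coefficient_Asp[OF RN(1,2) \<alpha> RN(4)])
  let ?XX = "prod_topology X X"
  define U where "U v = {z \<in> topspace ?XX. \<alpha> (fst z) v - \<alpha> (snd z) v \<in> - {0}}" for v
  have "second_countable ?XX" by (rule second_countable_square[OF assms(1)])
  moreover have "openin ?XX (U v)" for v
  proof -
    have c: "continuous_map X euclideanreal (\<lambda>x. \<alpha> x v)"
      using coefficient unfolding Asp_def by blast
    have "continuous_map ?XX euclideanreal (\<lambda>z. \<alpha> (fst z) v - \<alpha> (snd z) v)"
      using continuous_map_compose[OF continuous_map_fst c]
        continuous_map_compose[OF continuous_map_snd c]
      by (intro continuous_map_diff) (simp_all add: o_def)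
    then show ?thesis unfolding U_def by (rule openin_continuous_map_preimage) (simp add: open_Compl)
  qed
  ultimately obtain J where J: "countable J" "\<Union>(U ` J) = \<Union>(U ` UNIV)"
    using second_countable_countable_subfamily[of ?XX UNIV U] by metis
  show thesis
  proof
    show "countable ((\<lambda>v x. \<alpha> x v) ` J)" using J(1) by simp
    show "(\<lambda>v x. \<alpha> x v) ` J \<subseteq> Asp G X \<phi>" using coefficient by blast
    show "separates_points ((\<lambda>v x. \<alpha> x v) ` J) (topspace X)"
      unfolding separates_points_def
    proof (intro ballI impI)
      fix x y assume xy: "x \<in> topspace X" "y \<in> topspace X"
        and eq: "\<forall>f\<in>(\<lambda>v x. \<alpha> x v) ` J. f x = f y"
      have "(x, y) \<notin> \<Union>(U ` J)" using eq by (auto simp: U_def)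
      then have "(x, y) \<notin> \<Union>(U ` UNIV)" using J(2) by simp
      then have "\<alpha> x v = \<alpha> y v" for v using xy by (auto simp: U_def)
      then have "\<alpha> x = \<alpha> y" by (rule blinfun_eqI)
      then show "x = y" using inj xy by (auto dest: inj_onD)
    qed
  qed
qed

theorem
  assumes "metrizable_space X" "RN_G_space TYPE('v::banach) G TG X \<phi>"
  shows RN_enveloping_space_metrizable: "metrizable_space (enveloping_space G X \<phi>)"
    and RN_enveloping_space_Rosenthal: "Rosenthal_compact (enveloping_space G X \<phi>)"
proof -
  obtain F where F: "countable F" "F \<subseteq> Asp G X \<phi>"
    "separates_points F (topspace X)"
    using RN_countable_separating_Asp[OF assms] by blast
  obtain C where C: "countable C"
    "\<And>u. u \<in> C \<Longrightarrow> continuous_map (enveloping_space G X \<phi>) euclideanreal u"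
    "separates_points C (topspace (enveloping_space G X \<phi>))"
    using enveloping_space_countably_separated[OF assms(1) F] by blast
  show "metrizable_space (enveloping_space G X \<phi>)"
    by (rule countably_separated_metrizable[OF compact_enveloping_space C])
  show "Rosenthal_compact (enveloping_space G X \<phi>)"
    by (rule countably_separated_Rosenthal[OF compact_enveloping_space C])
qed

end

theorem theorem14p8:
  fixes G :: "('g, 'm) monoid_scheme" and TG :: "'g topology"
  assumes "topological_group G TG"
  shows "(\<forall>(X :: 'x topology) \<phi>. compact_G_space G TG X \<phi> \<and> metrizable_space X \<longrightarrow>
            (\<forall>f\<in>Asp G X \<phi>. Rosenthal_compact (enveloping_function_space G X \<phi> f)))
       \<and> (\<forall>(X :: 'x topology) \<phi>. compact_G_space G TG X \<phi> \<and> metrizable_space X \<and>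
              RN_G_space TYPE('v::banach) G TG X \<phi> \<longrightarrow>
            Rosenthal_compact (enveloping_space G X \<phi>) \<and>
            separable_space (enveloping_space G X \<phi>) \<and>
            topspace (enveloping_space G X \<phi>) \<lesssim> (UNIV :: nat set set) \<and>
            (\<nexists>S. S \<subseteq> topspace (enveloping_space G X \<phi>) \<and>
               subtopology (enveloping_space G X \<phi>) S homeomorphic_space beta_nat))"
proof (intro conjI allI impI; elim conjE)
  fix X :: "'x topology" and \<phi>
  assume "compact_G_space G TG X \<phi>" "metrizable_space X"
  then show "\<forall>f\<in>Asp G X \<phi>. Rosenthal_compact (enveloping_function_space G X \<phi> f)"
    using compact_G_space.Rosenthal_enveloping_function_space by blast
next
  fix X :: "'x topology" and \<phi>
  assume X: "compact_G_space G TG X \<phi>" "metrizable_space X"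
    and RN: "RN_G_space TYPE('v) G TG X \<phi>"
  interpret compact_G_space G TG X \<phi> by (rule X(1))
  let ?T = "enveloping_space G X \<phi>"
  have metrizable: "metrizable_space ?T" by (rule RN_enveloping_space_metrizable[OF X(2) RN])
  then have second: "second_countable ?T"
    using compact_enveloping_space by (rule compact_metrizable_imp_second_countable[rotated])
  show "Rosenthal_compact ?T" by (rule RN_enveloping_space_Rosenthal[OF X(2) RN])
  show "separable_space ?T" by (rule second_countable_imp_separable_space[OF second])
  show "topspace ?T \<lesssim> (UNIV :: nat set set)"
    by (rule second_countable_Hausdorff_lepoll[OF second Hausdorff_enveloping_space])
  show "\<nexists>S. S \<subseteq> topspace ?T \<and> subtopology ?T S homeomorphic_space beta_nat"
    using not_metrizable_beta_nat metrizable_space_subtopology[OF metrizable]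
      homeomorphic_metrizable_space by blast
qed

end
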